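(* Let $G$ be a first-order structure expanding a group, $T$ its complete theory, and $\mathbb{G}$ a sufficiently saturated monster model of $T$ (an elementary extension of $G$). Let $\varphi(x)$ be a formula in one variable with parameters from $G$. Then $\varphi(G)$ contains $B\cdot C$ for some infinite $B,C\subseteq G$ if and only if there are nonalgebraic global types $p,q\in S_1(\mathbb{G})$, both finitely satisfiable in $G$, such that $\varphi(x\cdot y)\in (p(x)\otimes q(y))\cap (q(y)\otimes p(x))$.
   Context: A global type is a complete type over $\mathbb{G}$; it is nonalgebraic if it has no realization in $\mathbb{G}$ (equivalently, is not realized by any element), and finitely satisfiable in $G$ if every formula in it is satisfied by some element of $G$; such a type is $G$-invariant. For global types $p,q\in S_1(\mathbb{G})$ with $p$ invariant over a small set $A$, $p(x)\otimes q(y)$ is the global type defined by: for a small $B\supseteq A$ and a formula $\theta(x,y)$ with parameters in $B$, $\theta(x,y)\in p(x)\otimes q(y)$ iff $\theta(x,c)\in p$ for some (any) $c$ realizing $q|_B$. $q(y)\otimes p(x)$ is defined symmetrically (using invariance of $q$). $\varphi(x\cdot y)$ denotes the formula obtained by substituting the product $x\cdot y$ for $x$. *)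

theory Defs
  imports Main "HOL-Algebra.Coset"
begin

unbundle cardinal_syntax

section \<open>First-order languages, structures and formulas\<close>

record ('f, 'r) language =
  funs :: "'f set"
  rels :: "'r set"
  farity :: "'f \<Rightarrow> nat"
  rarity :: "'r \<Rightarrow> nat"

text \<open>
  Formulas use de Bruijn indices: \<open>All\<close> binds index 0 of its body. Parameters are elements
  of the ambient type occurring directly in terms (\<open>Par a\<close> is the constant naming \<open>a\<close>), so an
  L(A)-formula is a formula whose parameters lie in A.
\<close>

datatype (tfuns: 'f, tparams: 'a) trm =
  Var nat
| Par 'a
| App 'f "('f, 'a) trm list"

datatype (ffuns: 'f, frels: 'r, params: 'a) fm =
  Eq "('f, 'a) trm" "('f, 'a) trm"
| Rel 'r "('f, 'a) trm list"
| Neg "('f, 'r, 'a) fm"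
| Conj "('f, 'r, 'a) fm" "('f, 'r, 'a) fm"
| All "('f, 'r, 'a) fm"

fun wf_trm :: "('f, 'r) language \<Rightarrow> ('f, 'a) trm \<Rightarrow> bool" where
  "wf_trm L (Var i) \<longleftrightarrow> True"
| "wf_trm L (Par a) \<longleftrightarrow> True"
| "wf_trm L (App f ts) \<longleftrightarrow>
     f \<in> funs L \<and> length ts = farity L f \<and> (\<forall>t \<in> set ts. wf_trm L t)"

fun wf_fm :: "('f, 'r) language \<Rightarrow> ('f, 'r, 'a) fm \<Rightarrow> bool" where
  "wf_fm L (Eq s t) \<longleftrightarrow> wf_trm L s \<and> wf_trm L t"
| "wf_fm L (Rel r ts) \<longleftrightarrow>
     r \<in> rels L \<and> length ts = rarity L r \<and> (\<forall>t \<in> set ts. wf_trm L t)"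
| "wf_fm L (Neg \<phi>) \<longleftrightarrow> wf_fm L \<phi>"
| "wf_fm L (Conj \<phi> \<psi>) \<longleftrightarrow> wf_fm L \<phi> \<and> wf_fm L \<psi>"
| "wf_fm L (All \<phi>) \<longleftrightarrow> wf_fm L \<phi>"

fun fv_trm :: "('f, 'a) trm \<Rightarrow> nat set" where
  "fv_trm (Var i) = {i}"
| "fv_trm (Par a) = {}"
| "fv_trm (App f ts) = (\<Union>t \<in> set ts. fv_trm t)"

fun fv :: "('f, 'r, 'a) fm \<Rightarrow> nat set" where
  "fv (Eq s t) = fv_trm s \<union> fv_trm t"
| "fv (Rel r ts) = (\<Union>t \<in> set ts. fv_trm t)"
| "fv (Neg \<phi>) = fv \<phi>"
| "fv (Conj \<phi> \<psi>) = fv \<phi> \<union> fv \<psi>"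
| "fv (All \<phi>) = {i. Suc i \<in> fv \<phi>}"

text \<open>The L(A)-formulas with free variables among \<open>V\<close>.\<close>

definition formulas ::
  "('f, 'r) language \<Rightarrow> 'a set \<Rightarrow> nat set \<Rightarrow> ('f, 'r, 'a) fm set" where
  "formulas L A V = {\<phi>. wf_fm L \<phi> \<and> params \<phi> \<subseteq> A \<and> fv \<phi> \<subseteq> V}"

fun subst_trm :: "(nat \<Rightarrow> ('f, 'a) trm) \<Rightarrow> ('f, 'a) trm \<Rightarrow> ('f, 'a) trm" where
  "subst_trm \<sigma> (Var i) = \<sigma> i"
| "subst_trm \<sigma> (Par a) = Par a"
| "subst_trm \<sigma> (App f ts) = App f (map (subst_trm \<sigma>) ts)"

text \<open>The substitution to use below a quantifier, so that no variable is captured.\<close>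

definition lift_subst :: "(nat \<Rightarrow> ('f, 'a) trm) \<Rightarrow> nat \<Rightarrow> ('f, 'a) trm" where
  "lift_subst \<sigma> = case_nat (Var 0) (\<lambda>i. subst_trm (\<lambda>j. Var (Suc j)) (\<sigma> i))"

fun subst :: "(nat \<Rightarrow> ('f, 'a) trm) \<Rightarrow> ('f, 'r, 'a) fm \<Rightarrow> ('f, 'r, 'a) fm" where
  "subst \<sigma> (Eq s t) = Eq (subst_trm \<sigma> s) (subst_trm \<sigma> t)"
| "subst \<sigma> (Rel r ts) = Rel r (map (subst_trm \<sigma>) ts)"
| "subst \<sigma> (Neg \<phi>) = Neg (subst \<sigma> \<phi>)"
| "subst \<sigma> (Conj \<phi> \<psi>) = Conj (subst \<sigma> \<phi>) (subst \<sigma> \<psi>)"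
| "subst \<sigma> (All \<phi>) = All (subst (lift_subst \<sigma>) \<phi>)"

record ('f, 'r, 'a) struct =
  univ :: "'a set"
  fint :: "'f \<Rightarrow> 'a list \<Rightarrow> 'a"
  rint :: "'r \<Rightarrow> 'a list \<Rightarrow> bool"

definition is_structure :: "('f, 'r) language \<Rightarrow> ('f, 'r, 'a) struct \<Rightarrow> bool" where
  "is_structure L M \<longleftrightarrow> univ M \<noteq> {} \<and>
     (\<forall>f \<in> funs L. \<forall>xs \<in> lists (univ M). length xs = farity L f \<longrightarrow> fint M f xs \<in> univ M)"

fun eval :: "('f, 'r, 'a) struct \<Rightarrow> (nat \<Rightarrow> 'a) \<Rightarrow> ('f, 'a) trm \<Rightarrow> 'a" where
  "eval M e (Var i) = e i"
| "eval M e (Par a) = a"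
| "eval M e (App f ts) = fint M f (map (eval M e) ts)"

fun sat :: "('f, 'r, 'a) struct \<Rightarrow> (nat \<Rightarrow> 'a) \<Rightarrow> ('f, 'r, 'a) fm \<Rightarrow> bool" where
  "sat M e (Eq s t) \<longleftrightarrow> eval M e s = eval M e t"
| "sat M e (Rel r ts) \<longleftrightarrow> rint M r (map (eval M e) ts)"
| "sat M e (Neg \<phi>) \<longleftrightarrow> \<not> sat M e \<phi>"
| "sat M e (Conj \<phi> \<psi>) \<longleftrightarrow> sat M e \<phi> \<and> sat M e \<psi>"
| "sat M e (All \<phi>) \<longleftrightarrow> (\<forall>a \<in> univ M. sat M (case_nat a e) \<phi>)"

text \<open>
  \<open>N\<close> is an elementary extension of \<open>M\<close>. Applied to atomic formulas, the last clause says in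
  particular that \<open>M\<close> is a substructure of \<open>N\<close>; applied to sentences, that \<open>N\<close> is a model of
  the complete theory of \<open>M\<close>.
\<close>

definition elementary_ext ::
  "('f, 'r) language \<Rightarrow> ('f, 'r, 'a) struct \<Rightarrow> ('f, 'r, 'a) struct \<Rightarrow> bool" where
  "elementary_ext L M N \<longleftrightarrow> is_structure L M \<and> is_structure L N \<and> univ M \<subseteq> univ N \<and>
     (\<forall>\<phi> \<in> formulas L {} UNIV. \<forall>e. range e \<subseteq> univ M \<longrightarrow> (sat M e \<phi> \<longleftrightarrow> sat N e \<phi>))"

text \<open>
  The structure \<open>G\<close> expands the group \<open>H\<close>, the group operation being the interpretation of the
  binary function symbol \<open>m\<close>.
\<close>

definition expands_group ::
  "('f, 'r) language \<Rightarrow> 'f \<Rightarrow> ('f, 'r, 'a) struct \<Rightarrow> ('a, 'b) monoid_scheme \<Rightarrow> bool" where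
  "expands_group L m G H \<longleftrightarrow> is_structure L G \<and> group H \<and> carrier H = univ G \<and>
     m \<in> funs L \<and> farity L m = 2 \<and>
     (\<forall>x \<in> univ G. \<forall>y \<in> univ G. fint G m [x, y] = x \<otimes>\<^bsub>H\<^esub> y)"


section \<open>Types in one variable\<close>

text \<open>
  One-variable formulas are formulas in the variable 0, and one-types are sets of such formulas,
  whichever variable they are later regarded as being in.
\<close>

definition satisfies :: "('f, 'r, 'a) struct \<Rightarrow> 'a \<Rightarrow> ('f, 'r, 'a) fm \<Rightarrow> bool" where
  "satisfies M a \<phi> \<longleftrightarrow> sat M (\<lambda>_. a) \<phi>"

definition solutions :: "('f, 'r, 'a) struct \<Rightarrow> ('f, 'r, 'a) fm \<Rightarrow> 'a set" where
  "solutions M \<phi> = {a \<in> univ M. satisfies M a \<phi>}"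

definition realizes ::
  "('f, 'r, 'a) struct \<Rightarrow> 'a \<Rightarrow> ('f, 'r, 'a) fm set \<Rightarrow> bool" where
  "realizes M a p \<longleftrightarrow> a \<in> univ M \<and> (\<forall>\<phi> \<in> p. satisfies M a \<phi>)"

text \<open>
  The space \<open>S\<^sub>1(A)\<close> of complete one-types over \<open>A\<close>; consistency with the elementary diagram of
  \<open>M\<close> is finite satisfiability in \<open>M\<close>. The global types are those over \<open>univ M\<close>.
\<close>

definition types1 ::
  "('f, 'r) language \<Rightarrow> ('f, 'r, 'a) struct \<Rightarrow> 'a set \<Rightarrow> ('f, 'r, 'a) fm set set" where
  "types1 L M A = {p. p \<subseteq> formulas L A {0} \<and>
     (\<forall>F. finite F \<and> F \<subseteq> p \<longrightarrow> (\<exists>a. realizes M a F)) \<and>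
     (\<forall>\<phi> \<in> formulas L A {0}. \<phi> \<in> p \<or> Neg \<phi> \<in> p)}"

definition restrict_type ::
  "('f, 'r) language \<Rightarrow> ('f, 'r, 'a) fm set \<Rightarrow> 'a set \<Rightarrow> ('f, 'r, 'a) fm set" where
  "restrict_type L p B = p \<inter> formulas L B {0}"

definition nonalgebraic :: "('f, 'r, 'a) struct \<Rightarrow> ('f, 'r, 'a) fm set \<Rightarrow> bool" where
  "nonalgebraic M p \<longleftrightarrow> \<not> (\<exists>a. realizes M a p)"

definition finitely_satisfiable_in ::
  "('f, 'r, 'a) struct \<Rightarrow> ('f, 'r, 'a) fm set \<Rightarrow> 'a set \<Rightarrow> bool" where
  "finitely_satisfiable_in M p A \<longleftrightarrow> (\<forall>\<phi> \<in> p. \<exists>a \<in> A. satisfies M a \<phi>)"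


section \<open>Saturation, monster models\<close>

definition saturated ::
  "('f, 'r) language \<Rightarrow> ('f, 'r, 'a) struct \<Rightarrow> 'k rel \<Rightarrow> bool" where
  "saturated L M \<kappa> \<longleftrightarrow>
     (\<forall>A. A \<subseteq> univ M \<and> |A| <o \<kappa> \<longrightarrow> (\<forall>p \<in> types1 L M A. \<exists>a. realizes M a p))"

text \<open>
  \<open>M\<close> is a monster model over \<open>G\<close>: an elementary extension that is saturated in a cardinal
  \<open>\<kappa>\<close> greater than the cardinalities of \<open>G\<close> and of the set of formulas of \<open>L\<close>. ``Small''
  means of cardinality less than \<open>\<kappa>\<close>. Strong homogeneity is not required, since invariance is
  defined below through equality of types rather than through automorphisms.
\<close>

definition monster ::
  "('f, 'r) language \<Rightarrow> ('f, 'r, 'a) struct \<Rightarrow> ('f, 'r, 'a) struct \<Rightarrow> 'k rel \<Rightarrow> bool" where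
  "monster L G M \<kappa> \<longleftrightarrow> elementary_ext L G M \<and>
     Card_order \<kappa> \<and> natLeq <o \<kappa> \<and> |univ G| <o \<kappa> \<and> |funs L| <o \<kappa> \<and> |rels L| <o \<kappa> \<and>
     saturated L M \<kappa>"


section \<open>Invariant types and their products\<close>

text \<open>
  Equality of the types over \<open>A\<close> of two finite tuples. Only the entries of the tuples matter,
  because the formulas have their free variables below the common length.
\<close>

definition same_type ::
  "('f, 'r) language \<Rightarrow> ('f, 'r, 'a) struct \<Rightarrow> 'a set \<Rightarrow> 'a list \<Rightarrow> 'a list \<Rightarrow> bool" where
  "same_type L M A bs cs \<longleftrightarrow> length bs = length cs \<and>
     (\<forall>\<psi> \<in> formulas L A {..<length bs}. sat M (nth bs) \<psi> \<longleftrightarrow> sat M (nth cs) \<psi>)"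

text \<open>
  \<open>A\<close>-invariance of a global type \<open>p(x)\<close>: whether \<open>\<theta>(x,b)\<close> belongs to \<open>p\<close> depends only on
  \<open>\<theta>\<close> and the type of the tuple \<open>b\<close> over \<open>A\<close>. In \<open>\<theta>\<close> the variable 0 is \<open>x\<close> and the variables
  \<open>1, \<dots>, n\<close> are to be replaced by the tuple.
\<close>

definition plug_tuple :: "'a list \<Rightarrow> nat \<Rightarrow> ('f, 'a) trm" where
  "plug_tuple bs = case_nat (Var 0) (\<lambda>i. Par (bs ! i))"

definition invariant ::
  "('f, 'r) language \<Rightarrow> ('f, 'r, 'a) struct \<Rightarrow> 'a set \<Rightarrow> ('f, 'r, 'a) fm set \<Rightarrow> bool" where
  "invariant L M A p \<longleftrightarrow>
     (\<forall>bs \<in> lists (univ M). \<forall>cs \<in> lists (univ M). same_type L M A bs cs \<longrightarrow>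
       (\<forall>\<theta> \<in> formulas L A {..length bs}.
          subst (plug_tuple bs) \<theta> \<in> p \<longleftrightarrow> subst (plug_tuple cs) \<theta> \<in> p))"

text \<open>
  The product \<open>p(v\<^sub>i) \<otimes> q(v\<^sub>j)\<close>, for distinct variables \<open>v\<^sub>i, v\<^sub>j\<close>, of a global type \<open>p\<close>
  invariant over a small set and a global type \<open>q\<close>: the formula \<open>\<theta>(v\<^sub>i,v\<^sub>j)\<close> belongs to it iff
  \<open>\<theta>(v\<^sub>i,c)\<close> belongs to \<open>p(v\<^sub>i)\<close> for some \<open>c\<close> realizing \<open>q\<close> restricted to \<open>B\<close>. As \<open>p\<close> is
  stored as a type in the variable 0, the substitution also renames \<open>v\<^sub>i\<close> to that variable.
\<close>

definition type_product ::
  "('f, 'r) language \<Rightarrow> ('f, 'r, 'a) struct \<Rightarrow> 'k rel \<Rightarrow>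
   nat \<Rightarrow> ('f, 'r, 'a) fm set \<Rightarrow> nat \<Rightarrow> ('f, 'r, 'a) fm set \<Rightarrow> ('f, 'r, 'a) fm set" where
  "type_product L M \<kappa> i p j q = {\<theta>. \<exists>A B c.
     invariant L M A p \<and> A \<subseteq> B \<and> B \<subseteq> univ M \<and> |B| <o \<kappa> \<and> \<theta> \<in> formulas L B {i, j} \<and>
     realizes M c (restrict_type L q B) \<and>
     subst (Var(i := Var 0, j := Par c)) \<theta> \<in> p}"

text \<open>\<open>\<phi>(x \<cdot> y)\<close>, with \<open>x\<close> the variable 0 and \<open>y\<close> the variable 1.\<close>

definition at_product :: "'f \<Rightarrow> ('f, 'r, 'a) fm \<Rightarrow> ('f, 'r, 'a) fm" where
  "at_product m \<phi> = subst (Var(0 := App m [Var 0, Var 1])) \<phi>"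

end

theory Submission imports Defs begin

text \<open>
  If \<open>\<phi>(G)\<close> contains \<open>B \<cdot> C\<close>, let \<open>p\<close> and \<open>q\<close> be maximal sets of formulas all of whose finite
  parts hold at infinitely many points of \<open>B\<close> and of \<open>C\<close>. If \<open>c\<close> realizes \<open>q\<close> over \<open>G\<close>, then
  \<open>\<phi>(b \<cdot> c)\<close> holds for each \<open>b \<in> B\<close>, so \<open>\<phi>(x \<cdot> c)\<close> is in \<open>p\<close>; the other product is symmetric.

  Conversely, choose \<open>c\<close> realizing \<open>q\<close> and \<open>d\<close> realizing \<open>p\<close> over \<open>G\<close> with \<open>\<phi>(x \<cdot> c) \<in> p\<close> and
  \<open>\<phi>(d \<cdot> y) \<in> q\<close>. Then \<open>b\<^sub>n\<close> and \<open>c\<^sub>n\<close> in \<open>G\<close> are built alternately, keeping \<open>\<phi>(b\<^sub>n \<cdot> c)\<close> and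
  \<open>\<phi>(d \<cdot> c\<^sub>n)\<close> true: the requirements on the next \<open>b\<^sub>n\<close> form a finite part of \<open>p\<close>, which is
  satisfied in \<open>G\<close>, and nonalgebraicity makes it new.
\<close>

section \<open>Substitution and abstraction of parameters\<close>

lemma eval_cong: "(\<And>i. i \<in> fv_trm t \<Longrightarrow> e i = e' i) \<Longrightarrow> eval M e t = eval M e' t"
proof (induction t)
  case (App f ts)
  then have "map (eval M e) ts = map (eval M e') ts" by auto
  then show ?case by (simp only: eval.simps)
qed auto

lemma sat_cong: "(\<And>i. i \<in> fv \<psi> \<Longrightarrow> e i = e' i) \<Longrightarrow> sat M e \<psi> \<longleftrightarrow> sat M e' \<psi>"
proof (induction \<psi> arbitrary: e e')
  case (Eq s t)
  then show ?case using eval_cong[of s e e' M] eval_cong[of t e e' M] by auto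
next
  case (Rel r ts)
  then have "map (eval M e) ts = map (eval M e') ts" by (auto intro!: eval_cong)
  then show ?case by (simp only: sat.simps)
next
  case (Neg \<psi>)
  then show ?case by (metis fv.simps(3) sat.simps(3))
next
  case (Conj \<psi> \<chi>)
  have "sat M e \<psi> \<longleftrightarrow> sat M e' \<psi>" by (rule Conj.IH) (simp add: Conj.prems)
  moreover have "sat M e \<chi> \<longleftrightarrow> sat M e' \<chi>" by (rule Conj.IH) (simp add: Conj.prems)
  ultimately show ?case by simp
next
  case (All \<psi>)
  have "sat M (case_nat a e) \<psi> \<longleftrightarrow> sat M (case_nat a e') \<psi>" for a
    by (rule All.IH) (use All.prems in \<open>auto split: nat.split\<close>)
  then show ?case by simp
qed

lemma eval_subst_trm: "eval M e (subst_trm \<sigma> t) = eval M (\<lambda>i. eval M e (\<sigma> i)) t"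
proof (induction t)
  case (App f ts)
  then have "map (eval M e \<circ> subst_trm \<sigma>) ts = map (eval M (\<lambda>i. eval M e (\<sigma> i))) ts" by auto
  then show ?case by (simp only: subst_trm.simps eval.simps map_map)
qed auto

lemma sat_subst: "sat M e (subst \<sigma> \<psi>) \<longleftrightarrow> sat M (\<lambda>i. eval M e (\<sigma> i)) \<psi>"
proof (induction \<psi> arbitrary: e \<sigma>)
  case (Rel r ts)
  have "map (eval M e \<circ> subst_trm \<sigma>) ts = map (eval M (\<lambda>i. eval M e (\<sigma> i))) ts"
    by (auto simp: eval_subst_trm)
  then show ?case by (simp only: subst.simps sat.simps map_map)
next
  case (All \<psi>)
  \<comment> \<open>The bound variable keeps index 0, and the lifted terms avoid that index, so the
    value \<open>a\<close> does not affect them.\<close>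
  have "(\<lambda>i. eval M (case_nat a e) (lift_subst \<sigma> i)) = case_nat a (\<lambda>i. eval M e (\<sigma> i))" for a
    by (auto simp: fun_eq_iff lift_subst_def eval_subst_trm split: nat.split)
  then show ?case using All by simp
qed (auto simp: eval_subst_trm)

lemma fv_subst_trm: "fv_trm (subst_trm \<sigma> t) = (\<Union>i \<in> fv_trm t. fv_trm (\<sigma> i))"
  by (induction t) auto

lemma tparams_subst_trm:
  "tparams (subst_trm \<sigma> t) = tparams t \<union> (\<Union>i \<in> fv_trm t. tparams (\<sigma> i))"
  by (induction t) auto

lemma wf_subst_trm:
  "wf_trm L t \<Longrightarrow> (\<And>i. i \<in> fv_trm t \<Longrightarrow> wf_trm L (\<sigma> i)) \<Longrightarrow> wf_trm L (subst_trm \<sigma> t)"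
  by (induction t) auto

lemma lift_subst_simps:
  "lift_subst \<sigma> 0 = Var 0"
  "fv_trm (lift_subst \<sigma> (Suc i)) = Suc ` fv_trm (\<sigma> i)"
  "tparams (lift_subst \<sigma> (Suc i)) = tparams (\<sigma> i)"
  by (auto simp: lift_subst_def fv_subst_trm tparams_subst_trm)

lemma fv_subst: "fv (subst \<sigma> \<psi>) \<subseteq> (\<Union>i \<in> fv \<psi>. fv_trm (\<sigma> i))"
proof (induction \<psi> arbitrary: \<sigma>)
  case (All \<psi>)
  show ?case
  proof
    fix k assume "k \<in> fv (subst \<sigma> (All \<psi>))"
    then obtain i where i: "i \<in> fv \<psi>" "Suc k \<in> fv_trm (lift_subst \<sigma> i)" using All by fastforce
    then show "k \<in> (\<Union>i \<in> fv (All \<psi>). fv_trm (\<sigma> i))"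
      by (cases i) (auto simp: lift_subst_simps)
  qed
next
  case (Conj \<psi> \<chi>)
  show ?case using Conj[of \<sigma>] by (simp add: UN_Un) blast
qed (auto simp: fv_subst_trm)

lemma params_subst: "params (subst \<sigma> \<psi>) \<subseteq> params \<psi> \<union> (\<Union>i \<in> fv \<psi>. tparams (\<sigma> i))"
proof (induction \<psi> arbitrary: \<sigma>)
  case (All \<psi>)
  show ?case
  proof
    fix a assume "a \<in> params (subst \<sigma> (All \<psi>))"
    then consider "a \<in> params \<psi>" | i where "i \<in> fv \<psi>" "a \<in> tparams (lift_subst \<sigma> i)"
      using All by fastforce
    then show "a \<in> params (All \<psi>) \<union> (\<Union>i \<in> fv (All \<psi>). tparams (\<sigma> i))"
    proof cases
      case (2 i)
      then show ?thesis by (cases i) (auto simp: lift_subst_simps)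
    qed simp
  qed
next
  case (Conj \<psi> \<chi>)
  show ?case using Conj[of \<sigma>] by (simp add: UN_Un) blast
qed (auto simp: tparams_subst_trm)

lemma wf_subst:
  "wf_fm L \<psi> \<Longrightarrow> (\<And>i. i \<in> fv \<psi> \<Longrightarrow> wf_trm L (\<sigma> i)) \<Longrightarrow> wf_fm L (subst \<sigma> \<psi>)"
proof (induction \<psi> arbitrary: \<sigma>)
  case (All \<psi>)
  have "wf_trm L (lift_subst \<sigma> i)" if "i \<in> fv \<psi>" for i
    using that All.prems(2) by (cases i) (auto simp: lift_subst_def intro!: wf_subst_trm)
  then show ?case using All by simp
qed (auto intro!: wf_subst_trm)

lemma subst_in_formulas:
  assumes "\<psi> \<in> formulas L A V" "A \<subseteq> B"
    and "\<And>i. i \<in> V \<Longrightarrow> wf_trm L (\<sigma> i) \<and> tparams (\<sigma> i) \<subseteq> B \<and> fv_trm (\<sigma> i) \<subseteq> W"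
  shows "subst \<sigma> \<psi> \<in> formulas L B W"
proof -
  have \<psi>: "wf_fm L \<psi>" "params \<psi> \<subseteq> A" "fv \<psi> \<subseteq> V" using assms(1) by (auto simp: formulas_def)
  have \<sigma>: "wf_trm L (\<sigma> i)" "tparams (\<sigma> i) \<subseteq> B" "fv_trm (\<sigma> i) \<subseteq> W" if "i \<in> fv \<psi>" for i
    using assms(3) \<psi>(3) that by auto
  have "wf_fm L (subst \<sigma> \<psi>)" by (rule wf_subst[OF \<psi>(1) \<sigma>(1)])
  moreover have "params (subst \<sigma> \<psi>) \<subseteq> B"
    using params_subst[of \<sigma> \<psi>] \<psi>(2) assms(2) \<sigma>(2) by fastforce
  moreover have "fv (subst \<sigma> \<psi>) \<subseteq> W" using fv_subst[of \<sigma> \<psi>] \<sigma>(3) by fastforce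
  ultimately show ?thesis by (simp add: formulas_def)
qed

section \<open>Replacing parameters by free variables\<close>

fun abs_trm :: "('a \<Rightarrow> nat) \<Rightarrow> ('f, 'a) trm \<Rightarrow> ('f, 'a) trm" where
  "abs_trm g (Var i) = Var i"
| "abs_trm g (Par a) = Var (g a)"
| "abs_trm g (App f ts) = App f (map (abs_trm g) ts)"

text \<open>Here \<open>g a\<close> is the variable that stands for the parameter \<open>a\<close>.
  Below a quantifier all free indices move up by one, hence \<open>Suc \<circ> g\<close>.\<close>

fun abs_fm :: "('a \<Rightarrow> nat) \<Rightarrow> ('f, 'r, 'a) fm \<Rightarrow> ('f, 'r, 'a) fm" where
  "abs_fm g (Eq s t) = Eq (abs_trm g s) (abs_trm g t)"
| "abs_fm g (Rel r ts) = Rel r (map (abs_trm g) ts)"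
| "abs_fm g (Neg \<psi>) = Neg (abs_fm g \<psi>)"
| "abs_fm g (Conj \<psi> \<chi>) = Conj (abs_fm g \<psi>) (abs_fm g \<chi>)"
| "abs_fm g (All \<psi>) = All (abs_fm (Suc \<circ> g) \<psi>)"

lemma eval_abs_trm: "(\<And>a. a \<in> tparams t \<Longrightarrow> e (g a) = a) \<Longrightarrow> eval M e (abs_trm g t) = eval M e t"
proof (induction t)
  case (App f ts)
  then have "map (eval M e \<circ> abs_trm g) ts = map (eval M e) ts" by auto
  then show ?case by (simp only: abs_trm.simps eval.simps map_map)
qed auto

lemma sat_abs_fm: "(\<And>a. a \<in> params \<psi> \<Longrightarrow> e (g a) = a) \<Longrightarrow> sat M e (abs_fm g \<psi>) \<longleftrightarrow> sat M e \<psi>"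
proof (induction \<psi> arbitrary: e g)
  case (Rel r ts)
  then have "map (eval M e \<circ> abs_trm g) ts = map (eval M e) ts" by (auto intro!: eval_abs_trm)
  then show ?case by (simp only: abs_fm.simps sat.simps map_map)
qed (auto simp: eval_abs_trm)

lemma abs_trm_props:
  "fv_trm (abs_trm g t) = fv_trm t \<union> g ` tparams t" "tparams (abs_trm g t) = {}"
  "wf_trm L t \<Longrightarrow> wf_trm L (abs_trm g t)"
  by (induction t) auto

lemma fv_abs_fm: "fv (abs_fm g \<psi>) = fv \<psi> \<union> g ` params \<psi>"
  by (induction \<psi> arbitrary: g) (auto simp: abs_trm_props)

lemma params_abs_fm: "params (abs_fm g \<psi>) = {}"
  by (induction \<psi> arbitrary: g) (auto simp: abs_trm_props)

lemma wf_abs_fm: "wf_fm L \<psi> \<Longrightarrow> wf_fm L (abs_fm g \<psi>)"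
  by (induction \<psi> arbitrary: g) (auto simp: abs_trm_props)

lemma finite_params: "finite (params \<psi>)"
proof -
  have trm: "finite (tparams t)" for t :: "('f, 'a) trm" by (induction t) auto
  show ?thesis by (induction \<psi>) (auto simp: trm)
qed

text \<open>Elementarity is stated for parameter-free formulas only, and invariance over
  \<open>A\<close> only for formulas over \<open>A\<close>. Parameters are therefore moved to
  variables from \<open>n\<close> on. One \<open>\<psi>'\<close> serves all structures, so that it
  can be compared in \<open>G\<close> and in \<open>M\<close>.\<close>

lemma abstract_parameters:
  fixes \<psi> :: "('f, 'r, 'a) fm"
  assumes "\<psi> \<in> formulas L A {..<n}"
  obtains ds \<psi>' where "set ds = params \<psi>" "\<psi>' \<in> formulas L {} {..<n + length ds}"
    "\<And>M e. (\<And>k. k < length ds \<Longrightarrow> e (n + k) = ds ! k) \<Longrightarrow> sat M e \<psi>' \<longleftrightarrow> sat M e \<psi>"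
proof -
  obtain ds where ds: "set ds = params \<psi>" using finite_list[OF finite_params[of \<psi>]] ..
  \<comment> \<open>The list \<open>ds\<close> may have repetitions; \<open>h\<close> picks one
    position for each parameter.\<close>
  have "\<forall>a. \<exists>k. a \<in> params \<psi> \<longrightarrow> k < length ds \<and> ds ! k = a"
    using ds by (metis in_set_conv_nth)
  then obtain h where h: "\<And>a. a \<in> params \<psi> \<Longrightarrow> h a < length ds \<and> ds ! h a = a" by metis
  show thesis
  proof
    show "set ds = params \<psi>" by (fact ds)
    show "abs_fm (\<lambda>a. n + h a) \<psi> \<in> formulas L {} {..<n + length ds}"
      using assms h by (auto simp: formulas_def fv_abs_fm params_abs_fm wf_abs_fm)
    show "sat M e (abs_fm (\<lambda>a. n + h a) \<psi>) \<longleftrightarrow> sat M e \<psi>"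
      if "\<And>k. k < length ds \<Longrightarrow> e (n + k) = ds ! k" for M :: "('f, 'r, 'a) struct" and e
      by (rule sat_abs_fm) (use that h in auto)
  qed
qed

section \<open>Transfer of truth between \<open>G\<close> and \<open>M\<close>\<close>

lemma elementary_ext_satisfies:
  fixes G M :: "('f, 'r, 'a) struct"
  assumes "elementary_ext L G M" "\<psi> \<in> formulas L (univ G) {0}" "a \<in> univ G"
  shows "satisfies G a \<psi> \<longleftrightarrow> satisfies M a \<psi>"
proof -
  have \<psi>: "\<psi> \<in> formulas L (univ G) {..<1}" using assms(2) by (simp add: lessThan_Suc)
  obtain ds \<psi>' where ds: "set ds = params \<psi>" "\<psi>' \<in> formulas L {} {..<1 + length ds}"
    and sat': "\<And>M e. (\<And>k. k < length ds \<Longrightarrow> e (1 + k) = ds ! k) \<Longrightarrow> sat M e \<psi>' \<longleftrightarrow> sat M e \<psi>"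
    by (rule abstract_parameters[OF \<psi>]) blast
  \<comment> \<open>The former parameters become values of the variables from 1 on. The default
    \<open>a\<close> keeps the whole valuation inside \<open>G\<close>, as elementarity
    demands.\<close>
  define e where "e = case_nat a (\<lambda>k. if k < length ds then ds ! k else a)"
  have dsG: "set ds \<subseteq> univ G" using ds assms(2) by (auto simp: formulas_def)
  have "e i \<in> univ G" for i
    using dsG assms(3) by (auto simp: e_def split: nat.split)
  then have "range e \<subseteq> univ G" by blast
  moreover have "\<psi>' \<in> formulas L {} UNIV" using ds by (auto simp: formulas_def)
  ultimately have "sat G e \<psi>' \<longleftrightarrow> sat M e \<psi>'" using assms(1) by (auto simp: elementary_ext_def)
  moreover have "sat N e \<psi>' \<longleftrightarrow> satisfies N a \<psi>" for N :: "('f, 'r, 'a) struct"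
  proof -
    have "sat N e \<psi>' \<longleftrightarrow> sat N e \<psi>" by (rule sat') (simp add: e_def)
    also have "\<dots> \<longleftrightarrow> sat N (\<lambda>_. a) \<psi>"
      by (rule sat_cong) (use assms(2) in \<open>auto simp: formulas_def e_def\<close>)
    finally show ?thesis by (simp add: satisfies_def)
  qed
  ultimately show ?thesis by simp
qed

lemma elementary_ext_fint:
  fixes G M :: "('f, 'r, 'a) struct"
  assumes "elementary_ext L G M" "f \<in> funs L" "farity L f = 2" "a \<in> univ G" "b \<in> univ G"
  shows "fint M f [a, b] = fint G f [a, b]"
proof -
  \<comment> \<open>Variable 2 takes the value computed in \<open>G\<close>, so
    \<open>?\<psi>\<close> is trivially true there; its truth in \<open>M\<close> is the
    claim.\<close>
  let ?e = "case_nat a (case_nat b (\<lambda>_. fint G f [a, b]))"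
  let ?\<psi> = "Eq (App f [Var 0, Var 1]) (Var 2) :: ('f, 'r, 'a) fm"
  have "fint G f [a, b] \<in> univ G"
    using assms by (auto simp: elementary_ext_def is_structure_def)
  then have "range ?e \<subseteq> univ G" using assms by (auto split: nat.splits)
  moreover have "?\<psi> \<in> formulas L {} UNIV" using assms by (auto simp: formulas_def)
  ultimately have "sat G ?e ?\<psi> \<longleftrightarrow> sat M ?e ?\<psi>" using assms(1) unfolding elementary_ext_def by blast
  then show ?thesis by (simp add: numeral_2_eq_2)
qed


section \<open>Complete types\<close>

lemma types1_subset: "p \<in> types1 L M A \<Longrightarrow> \<psi> \<in> p \<Longrightarrow> \<psi> \<in> formulas L A {0}"
  by (auto simp: types1_def)

lemma Neg_in_formulas: "Neg \<psi> \<in> formulas L A V \<longleftrightarrow> \<psi> \<in> formulas L A V"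
  by (simp add: formulas_def)

text \<open>Otherwise \<open>Neg \<chi>\<close> is in \<open>p\<close> by completeness, and a common
  realization of it and \<open>F\<close> contradicts the implication. Membership in a type is thus
  proved by semantic consequence in \<open>M\<close>.\<close>

lemma types1_closed:
  assumes p: "p \<in> types1 L M A" and "finite F" "F \<subseteq> p" and \<chi>: "\<chi> \<in> formulas L A {0}"
    and imp: "\<And>a. a \<in> univ M \<Longrightarrow> (\<And>\<psi>. \<psi> \<in> F \<Longrightarrow> satisfies M a \<psi>) \<Longrightarrow> satisfies M a \<chi>"
  shows "\<chi> \<in> p"
proof (rule ccontr)
  assume "\<chi> \<notin> p"
  then have "Neg \<chi> \<in> p" using p \<chi> by (auto simp: types1_def)
  then have "finite (insert (Neg \<chi>) F) \<and> insert (Neg \<chi>) F \<subseteq> p" using assms by simp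
  then obtain a where "realizes M a (insert (Neg \<chi>) F)" using p unfolding types1_def by blast
  then show False using imp[of a] by (auto simp: realizes_def satisfies_def)
qed

lemma types1_Neg_iff:
  assumes p: "p \<in> types1 L M A" and \<psi>: "\<psi> \<in> formulas L A {0}"
  shows "Neg \<psi> \<in> p \<longleftrightarrow> \<psi> \<notin> p"
proof
  assume "Neg \<psi> \<in> p"
  show "\<psi> \<notin> p"
  proof
    assume "\<psi> \<in> p"
    then have "finite {\<psi>, Neg \<psi>} \<and> {\<psi>, Neg \<psi>} \<subseteq> p" using \<open>Neg \<psi> \<in> p\<close> by simp
    then obtain a where "realizes M a {\<psi>, Neg \<psi>}" using p unfolding types1_def by blast
    then show False by (auto simp: realizes_def satisfies_def)
  qed
qed (use p \<psi> in \<open>auto simp: types1_def\<close>)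

lemma types1_cong:
  assumes "p \<in> types1 L M A" "\<psi> \<in> formulas L A {0}" "\<chi> \<in> formulas L A {0}"
    and "\<And>a. a \<in> univ M \<Longrightarrow> satisfies M a \<psi> \<longleftrightarrow> satisfies M a \<chi>"
  shows "\<psi> \<in> p \<longleftrightarrow> \<chi> \<in> p"
  using types1_closed[OF assms(1), of "{\<psi>}" \<chi>] types1_closed[OF assms(1), of "{\<chi>}" \<psi>] assms
  by auto

lemma formulas_mono: "A \<subseteq> B \<Longrightarrow> V \<subseteq> W \<Longrightarrow> formulas L A V \<subseteq> formulas L B W"
  by (auto simp: formulas_def)

text \<open>Either \<open>\<psi>\<close> or its negation belongs to the restriction, so what
  \<open>c\<close> satisfies over \<open>B\<close> is exactly what \<open>q\<close>
  contains.\<close>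

lemma realizes_restrict_iff:
  assumes "q \<in> types1 L M (univ M)" "B \<subseteq> univ M" "realizes M c (restrict_type L q B)"
    and \<psi>: "\<psi> \<in> formulas L B {0}"
  shows "satisfies M c \<psi> \<longleftrightarrow> \<psi> \<in> q"
proof -
  have "\<psi> \<in> formulas L (univ M) {0}" using \<psi> formulas_mono[OF assms(2)] by blast
  then have "Neg \<psi> \<in> q \<longleftrightarrow> \<psi> \<notin> q" by (rule types1_Neg_iff[OF assms(1)])
  moreover have "sat M (\<lambda>_. c) \<chi>" if "\<chi> \<in> q" "\<chi> \<in> formulas L B {0}" for \<chi>
    using assms(3) that by (simp add: realizes_def restrict_type_def satisfies_def)
  from this[of \<psi>] this[of "Neg \<psi>"] have "\<psi> \<in> q \<Longrightarrow> satisfies M c \<psi>" "Neg \<psi> \<in> q \<Longrightarrow> \<not> satisfies M c \<psi>"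
    using \<psi> by (auto simp: satisfies_def Neg_in_formulas)
  ultimately show ?thesis by blast
qed

lemma restrict_type_in_types1:
  assumes "q \<in> types1 L M (univ M)" "B \<subseteq> univ M"
  shows "restrict_type L q B \<in> types1 L M B"
proof -
  have "\<psi> \<in> restrict_type L q B \<or> Neg \<psi> \<in> restrict_type L q B" if "\<psi> \<in> formulas L B {0}" for \<psi>
  proof -
    have "\<psi> \<in> formulas L (univ M) {0}" using that formulas_mono[OF assms(2)] by blast
    then show ?thesis
      using types1_Neg_iff[OF assms(1)] that by (auto simp: restrict_type_def Neg_in_formulas)
  qed
  moreover have "\<exists>a. realizes M a F" if "finite F \<and> F \<subseteq> restrict_type L q B" for F
  proof -
    have "finite F \<and> F \<subseteq> q" using that by (auto simp: restrict_type_def)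
    then show ?thesis using assms(1) unfolding types1_def by blast
  qed
  ultimately show ?thesis by (simp add: types1_def restrict_type_def)
qed

text \<open>Finite satisfiability is defined for single formulas; a finite part of \<open>p\<close>
  is first condensed into one member of \<open>p\<close> that implies all of it.\<close>

lemma finitely_satisfiable_in_finite:
  assumes p: "p \<in> types1 L M A" and fs: "finitely_satisfiable_in M p G"
    and "finite F" "F \<subseteq> p"
  shows "\<exists>a\<in>G. \<forall>\<psi>\<in>F. satisfies M a \<psi>"
proof -
  have "\<exists>\<chi>\<in>p. \<forall>a. satisfies M a \<chi> \<longrightarrow> (\<forall>\<psi>\<in>F. satisfies M a \<psi>)"
    using assms(3,4)
  proof (induction F)
    case empty
    \<comment> \<open>This tautology plays the empty conjunction.\<close>
    have "Eq (Var 0) (Var 0) \<in> p"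
      by (rule types1_closed[OF p, of "{}"]) (auto simp: formulas_def satisfies_def)
    then show ?case by blast
  next
    case (insert \<psi> F)
    then obtain \<chi> where \<chi>: "\<chi> \<in> p" "\<forall>a. satisfies M a \<chi> \<longrightarrow> (\<forall>\<psi>\<in>F. satisfies M a \<psi>)" by auto
    have "Conj \<psi> \<chi> \<in> p"
    proof (rule types1_closed[OF p, of "{\<psi>, \<chi>}"])
      show "Conj \<psi> \<chi> \<in> formulas L A {0}"
        using insert.prems \<chi> types1_subset[OF p, of \<psi>] types1_subset[OF p, of \<chi>]
        by (auto simp: formulas_def)
    qed (use insert.prems \<chi> in \<open>auto simp: satisfies_def\<close>)
    then show ?case using \<chi>(2)
      by (metis insert_iff sat.simps(4) satisfies_def)
  qed
  then show ?thesis using fs unfolding finitely_satisfiable_in_def by blast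
qed

text \<open>If \<open>a\<close> does not realize \<open>p\<close>, some formula of \<open>p\<close>
  fails at \<open>a\<close> and so implies \<open>x \<noteq> a\<close>. In this form nonalgebraicity
  can be added to a finite part of \<open>p\<close> to avoid given points.\<close>

lemma nonalgebraic_iff_neq:
  assumes p: "p \<in> types1 L M (univ M)"
  shows "nonalgebraic M p \<longleftrightarrow> (\<forall>a\<in>univ M. Neg (Eq (Var 0) (Par a)) \<in> p)"
proof
  assume na: "nonalgebraic M p"
  show "\<forall>a\<in>univ M. Neg (Eq (Var 0) (Par a)) \<in> p"
  proof
    fix a assume a: "a \<in> univ M"
    then obtain \<psi> where \<psi>: "\<psi> \<in> p" "\<not> satisfies M a \<psi>"
      using na by (auto simp: nonalgebraic_def realizes_def)
    show "Neg (Eq (Var 0) (Par a)) \<in> p"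
      by (rule types1_closed[OF p, of "{\<psi>}"])
        (use \<psi> a in \<open>auto simp: formulas_def satisfies_def\<close>)
  qed
next
  assume neq: "\<forall>a\<in>univ M. Neg (Eq (Var 0) (Par a)) \<in> p"
  have "\<not> realizes M a p" for a
  proof
    assume "realizes M a p"
    then have "satisfies M a (Neg (Eq (Var 0) (Par a)))" using neq by (simp add: realizes_def)
    then show False by (simp add: satisfies_def)
  qed
  then show "nonalgebraic M p" by (simp add: nonalgebraic_def)
qed

section \<open>Construction of a type on an infinite set\<close>

lemma exists_type_on_infinite_set:
  fixes M :: "('f, 'r, 'a) struct"
  assumes "infinite B" "B \<subseteq> univ M"
  obtains p where "p \<in> types1 L M (univ M)" "nonalgebraic M p" "finitely_satisfiable_in M p B"
    "\<And>\<psi>. \<psi> \<in> formulas L (univ M) {0} \<Longrightarrow> (\<And>b. b \<in> B \<Longrightarrow> satisfies M b \<psi>) \<Longrightarrow> \<psi> \<in> p"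
proof -
  define S where "S F = {b\<in>B. \<forall>\<psi>\<in>F. satisfies M b \<psi>}" for F :: "('f, 'r, 'a) fm set"
  \<comment> \<open>Asking for infinitely many points, not just one, is what makes the maximal set
    nonalgebraic.\<close>
  define \<P> where "\<P> = {p. p \<subseteq> formulas L (univ M) {0} \<and>
    (\<forall>F. finite F \<and> F \<subseteq> p \<longrightarrow> infinite (S F))}"
  have "\<exists>p\<in>\<P>. \<forall>X\<in>\<P>. p \<subseteq> X \<longrightarrow> X = p"
  proof (rule subset_Zorn_nonempty)
    have "{} \<in> \<P>" using assms by (auto simp: \<P>_def S_def)
    then show "\<P> \<noteq> {}" by blast
    \<comment> \<open>A finite subset of the union of a chain already lies in one of its
      members.\<close>
    show "\<Union>\<C> \<in> \<P>" if "\<C> \<noteq> {}" and chain: "subset.chain \<P> \<C>" for \<C>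
    proof -
      have "infinite (S F)" if F: "finite F" "F \<subseteq> \<Union>\<C>" for F
      proof -
        obtain X where "X \<in> \<C>" "F \<subseteq> X"
          using finite_subset_Union_chain[OF F \<open>\<C> \<noteq> {}\<close> chain] by blast
        then show ?thesis using F chain by (auto simp: \<P>_def subset_chain_def)
      qed
      then show ?thesis using chain by (fastforce simp: \<P>_def subset_chain_def)
    qed
  qed
  then obtain p where p: "p \<in> \<P>" and max: "\<And>X. X \<in> \<P> \<Longrightarrow> p \<subseteq> X \<Longrightarrow> X = p" by blast
  have inf: "infinite (S F)" if "finite F" "F \<subseteq> p" for F using p that by (auto simp: \<P>_def)
  \<comment> \<open>By maximality, adding \<open>\<psi>\<close> breaks the defining condition at
    some finite set; deleting \<open>\<psi>\<close> from that set leaves a part of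
    \<open>p\<close>.\<close>
  have cofinite_neg: "\<exists>F. finite F \<and> F \<subseteq> p \<and> finite (S (insert \<psi> F))"
    if \<psi>: "\<psi> \<in> formulas L (univ M) {0}" "\<psi> \<notin> p" for \<psi>
  proof -
    have "insert \<psi> p \<notin> \<P>" using max[of "insert \<psi> p"] \<psi> by blast
    then obtain F where F: "finite F" "F \<subseteq> insert \<psi> p" "finite (S F)"
      using p \<psi> by (auto simp: \<P>_def)
    have "S (insert \<psi> (F - {\<psi>})) \<subseteq> S F" by (auto simp: S_def)
    then show ?thesis using F by (intro exI[of _ "F - {\<psi>}"]) (auto intro: finite_subset)
  qed
  have complete: "\<psi> \<in> p \<or> Neg \<psi> \<in> p" if \<psi>: "\<psi> \<in> formulas L (univ M) {0}" for \<psi>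
  proof (rule ccontr)
    assume "\<not> ?thesis"
    then obtain F F' where "finite F" "F \<subseteq> p" "finite (S (insert \<psi> F))"
      and "finite F'" "F' \<subseteq> p" "finite (S (insert (Neg \<psi>) F'))"
      using cofinite_neg[of \<psi>] cofinite_neg[of "Neg \<psi>"] \<psi> Neg_in_formulas[of \<psi>] by metis
    \<comment> \<open>Each point satisfies \<open>\<psi>\<close> or its negation, so the infinite
      set on the left would be covered by two finite ones.\<close>
    moreover have "S (F \<union> F') \<subseteq> S (insert \<psi> F) \<union> S (insert (Neg \<psi>) F')"
      by (auto simp: S_def satisfies_def)
    ultimately show False using inf[of "F \<union> F'"] by (meson finite_UnI finite_subset le_sup_iff)
  qed
  have sat: "\<exists>b\<in>B. \<forall>\<psi>\<in>F. satisfies M b \<psi>" if "finite F" "F \<subseteq> p" for F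
    using inf[OF that] not_finite_existsD[of "\<lambda>b. b \<in> S F"] by (auto simp: S_def)
  \<comment> \<open>Exceptions at finitely many points of \<open>B\<close> do no harm. This yields
    both \<open>x \<noteq> a\<close> and the formulas true throughout \<open>B\<close>.\<close>
  have mem: "\<psi> \<in> p" if "\<psi> \<in> formulas L (univ M) {0}" "finite {b\<in>B. \<not> satisfies M b \<psi>}" for \<psi>
  proof (rule ccontr)
    assume "\<psi> \<notin> p"
    then have "Neg \<psi> \<in> p" using complete that by blast
    then have "infinite (S {Neg \<psi>})" using inf[of "{Neg \<psi>}"] by simp
    then show False using that by (simp add: S_def satisfies_def)
  qed
  have type: "p \<in> types1 L M (univ M)"
  proof -
    have "p \<subseteq> formulas L (univ M) {0}" using p by (auto simp: \<P>_def)
    moreover have "\<exists>a. realizes M a F" if "finite F \<and> F \<subseteq> p" for F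
      using sat[of F] that assms by (auto simp: realizes_def)
    ultimately show ?thesis using complete by (simp add: types1_def)
  qed
  show thesis
  proof
    show "nonalgebraic M p" unfolding nonalgebraic_iff_neq[OF type]
    proof
      fix a assume "a \<in> univ M"
      moreover have "finite {b \<in> B. b = a}" by (rule finite_subset[of _ "{a}"]) auto
      ultimately show "Neg (Eq (Var 0) (Par a)) \<in> p"
        by (intro mem) (auto simp: formulas_def satisfies_def)
    qed
    show "finitely_satisfiable_in M p B"
      unfolding finitely_satisfiable_in_def
    proof
      fix \<psi> assume "\<psi> \<in> p"
      then show "\<exists>b\<in>B. satisfies M b \<psi>" using sat[of "{\<psi>}"] by simp
    qed
    show "\<psi> \<in> p" if "\<psi> \<in> formulas L (univ M) {0}" "\<And>b. b \<in> B \<Longrightarrow> satisfies M b \<psi>" for \<psi>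
    proof -
      have none: "{b\<in>B. \<not> satisfies M b \<psi>} = {}" using that by blast
      show ?thesis by (rule mem[OF that(1)]) (simp only: none finite.emptyI)
    qed
  qed (fact type)
qed


section \<open>Products of types\<close>

text \<open>Only \<open>i\<close> and \<open>j\<close> are free in \<open>\<theta>\<close>, so a
  valuation constant except at \<open>j\<close> encodes the pair. The two products are then treated
  alike, with the variables exchanged.\<close>

lemma satisfies_product_instance:
  assumes "\<theta> \<in> formulas L A {i, j}" "i \<noteq> j"
  shows "satisfies M a (subst (Var(i := Var 0, j := Par c)) \<theta>) \<longleftrightarrow> sat M ((\<lambda>_. a)(j := c)) \<theta>"
  unfolding satisfies_def sat_subst
  by (rule sat_cong) (use assms in \<open>auto simp: formulas_def\<close>)

lemma product_instance_in_formulas: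
  assumes "\<theta> \<in> formulas L A {i, j}" "A \<subseteq> B" "c \<in> B"
  shows "subst (Var(i := Var 0, j := Par c)) \<theta> \<in> formulas L B {0}"
  by (rule subst_in_formulas[OF assms(1,2)]) (use assms in auto)

lemma plug_tuple_in_formulas:
  assumes "\<theta> \<in> formulas L A {..length bs}" "A \<subseteq> B" "set bs \<subseteq> B"
  shows "subst (plug_tuple bs) \<theta> \<in> formulas L B {0}"
proof (rule subst_in_formulas[OF assms(1,2)])
  fix i assume i: "i \<in> {..length bs}"
  show "wf_trm L (plug_tuple bs i) \<and> tparams (plug_tuple bs i) \<subseteq> B \<and>
      fv_trm (plug_tuple bs i) \<subseteq> {0}"
  proof (cases i)
    case (Suc k)
    then have "bs ! k \<in> set bs" using i by simp
    then show ?thesis using assms Suc by (auto simp: plug_tuple_def)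
  qed (simp add: plug_tuple_def)
qed

lemma satisfies_plug_tuple:
  "satisfies M a (subst (plug_tuple bs) \<theta>) \<longleftrightarrow> sat M (case_nat a (nth bs)) \<theta>"
  unfolding satisfies_def sat_subst
  by (rule sat_cong) (auto simp: plug_tuple_def split: nat.split)

text \<open>If \<open>p\<close> contained \<open>\<theta>(x,bs)\<close> but not
  \<open>\<theta>(x,cs)\<close>, some \<open>g\<close> in \<open>G\<close> would satisfy the first
  and not the second. Then \<open>\<theta>(g,y)\<close> is a formula over \<open>G\<close> that
  separates the two tuples.\<close>

lemma finitely_satisfiable_in_imp_invariant:
  assumes p: "p \<in> types1 L M (univ M)" and fs: "finitely_satisfiable_in M p G" and "G \<subseteq> univ M"
  shows "invariant L M G p"
proof -
  have imp: "subst (plug_tuple cs) \<theta> \<in> p"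
    if bs: "set bs \<subseteq> univ M" and cs: "set cs \<subseteq> univ M" and st: "same_type L M G bs cs"
      and \<theta>: "\<theta> \<in> formulas L G {..length bs}" and mem: "subst (plug_tuple bs) \<theta> \<in> p" for bs cs \<theta>
  proof (rule ccontr)
    assume nmem: "subst (plug_tuple cs) \<theta> \<notin> p"
    have "\<theta> \<in> formulas L G {..length cs}" using \<theta> st by (simp add: same_type_def)
    from plug_tuple_in_formulas[OF this \<open>G \<subseteq> univ M\<close> cs]
    have "Neg (subst (plug_tuple cs) \<theta>) \<in> p" using types1_Neg_iff[OF p] nmem by blast
    then obtain g where g: "g \<in> G" "satisfies M g (subst (plug_tuple bs) \<theta>)"
      "satisfies M g (Neg (subst (plug_tuple cs) \<theta>))"
      using finitely_satisfiable_in_finite[OF p fs,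
          of "{subst (plug_tuple bs) \<theta>, Neg (subst (plug_tuple cs) \<theta>)}"] mem by auto
    then have diff: "sat M (case_nat g (nth bs)) \<theta>" "\<not> sat M (case_nat g (nth cs)) \<theta>"
      using satisfies_plug_tuple by (metis, metis sat.simps(3) satisfies_def)
    \<comment> \<open>Filling variable 0 with \<open>g\<close> also shifts the tuple variables down,
      to start at 0 as in \<open>same_type\<close>.\<close>
    let ?\<psi> = "subst (case_nat (Par g) Var) \<theta>"
    have "?\<psi> \<in> formulas L G {..<length bs}"
      by (rule subst_in_formulas[OF \<theta> order_refl]) (use g in \<open>auto split: nat.splits\<close>)
    then have "sat M (nth bs) ?\<psi> \<longleftrightarrow> sat M (nth cs) ?\<psi>" using st by (simp add: same_type_def)
    moreover have "(\<lambda>i. eval M e (case_nat (Par g) Var i)) = case_nat g e" for e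
      by (auto simp: fun_eq_iff split: nat.split)
    ultimately show False using diff by (simp add: sat_subst)
  qed
  have sym: "same_type L M G cs bs" if "same_type L M G bs cs" for bs cs
    using that by (simp add: same_type_def)
  show ?thesis
    unfolding invariant_def
  proof (intro ballI impI)
    fix bs cs \<theta>
    assume bc: "bs \<in> lists (univ M)" "cs \<in> lists (univ M)" and st: "same_type L M G bs cs"
      and \<theta>: "\<theta> \<in> formulas L G {..length bs}"
    have "\<theta> \<in> formulas L G {..length cs}" using \<theta> st by (simp add: same_type_def)
    then show "subst (plug_tuple bs) \<theta> \<in> p \<longleftrightarrow> subst (plug_tuple cs) \<theta> \<in> p"
      using imp[OF _ _ st \<theta>] imp[OF _ _ sym[OF st]] bc by (auto simp: lists_eq_set)
  qed
qed

text \<open>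
  The base of the product can be enlarged: \<open>A\<close>-invariance of \<open>p\<close> transfers to formulas over the
  larger base \<open>B\<close> by moving their parameters from \<open>B\<close> into the tuple.
\<close>

lemma type_product_realization:
  fixes M :: "('f, 'r, 'a) struct"
  assumes p: "p \<in> types1 L M (univ M)" and q: "q \<in> types1 L M (univ M)" and "i \<noteq> j"
    and sat: "saturated L M \<kappa>" and \<kappa>: "Card_order \<kappa>" "natLeq <o \<kappa>"
    and D: "D \<subseteq> univ M" "|D| <o \<kappa>"
    and \<theta>: "\<theta> \<in> type_product L M \<kappa> i p j q"
  obtains c where "realizes M c (restrict_type L q D)"
    "subst (Var(i := Var 0, j := Par c)) \<theta> \<in> p"
proof -
  from \<theta> obtain A B c where inv: "invariant L M A p" and B: "A \<subseteq> B" "B \<subseteq> univ M" "|B| <o \<kappa>"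
    and \<theta>: "\<theta> \<in> formulas L B {i, j}" and c: "realizes M c (restrict_type L q B)"
    and mem: "subst (Var(i := Var 0, j := Par c)) \<theta> \<in> p"
    by (auto simp: type_product_def)
  have "infinite (Field \<kappa>)"
    using \<kappa> Card_order_iff_ordLeq_card_of cinfinite_def cinfinite_mono natLeq_cinfinite ordLess_imp_ordLeq
    by blast
  then have "|B \<union> D| <o \<kappa>" using card_of_Un_ordLess_infinite_Field \<kappa> B D by blast
  moreover have "restrict_type L q (B \<union> D) \<in> types1 L M (B \<union> D)"
    using q B D by (simp add: restrict_type_in_types1)
  \<comment> \<open>A single realization over \<open>B \<union> D\<close> links the base given with
    \<open>\<theta>\<close> to the wanted base; it remains to replace \<open>c\<close> by
    \<open>c'\<close> in the formula that lies in \<open>p\<close>.\<close>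
  ultimately obtain c' where "realizes M c' (restrict_type L q (B \<union> D))"
    using sat B D unfolding saturated_def by (meson Un_least)
  then have c'B: "realizes M c' (restrict_type L q B)" and c'D: "realizes M c' (restrict_type L q D)"
    using formulas_mono[of B "B \<union> D" "{0}" "{0}" L] formulas_mono[of D "B \<union> D" "{0}" "{0}" L]
    by (auto simp: realizes_def restrict_type_def)
  have cM: "c \<in> univ M" "c' \<in> univ M" using c c'B by (auto simp: realizes_def)
  \<comment> \<open>Renumbering puts \<open>x\<close> at 0 and the place of \<open>c\<close> at 1,
    leaving the indices from 2 on for the parameters.\<close>
  have "subst (Var(i := Var 0, j := Var 1)) \<theta> \<in> formulas L B {..<2}"
    by (rule subst_in_formulas[OF \<theta> order_refl]) auto
  then obtain ds \<theta>' where ds: "set ds = params (subst (Var(i := Var 0, j := Var 1)) \<theta>)"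
    and \<theta>': "\<theta>' \<in> formulas L {} {..<2 + length ds}"
    and sat': "\<And>M e. (\<And>k. k < length ds \<Longrightarrow> e (2 + k) = ds ! k) \<Longrightarrow>
      sat M e \<theta>' \<longleftrightarrow> sat M e (subst (Var(i := Var 0, j := Var 1)) \<theta>)"
    by (rule abstract_parameters) blast
  have dsB: "set ds \<subseteq> B"
    using ds \<open>subst (Var(i := Var 0, j := Var 1)) \<theta> \<in> formulas L B {..<2}\<close>
    by (auto simp: formulas_def)
  \<comment> \<open>Since \<open>ds\<close> lies in \<open>B\<close>, a formula over
    \<open>A\<close> about these tuples becomes one over \<open>B\<close> about the head, and
    \<open>c\<close> and \<open>c'\<close> have the same type over \<open>B\<close>.\<close>
  have st: "same_type L M A (c # ds) (c' # ds)"
    unfolding same_type_def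
  proof (intro conjI ballI)
    fix \<psi> assume \<psi>: "\<psi> \<in> formulas L A {..<length (c # ds)}"
    have "\<psi> \<in> formulas L A {..length ds}" using \<psi> by (simp add: lessThan_Suc_atMost)
    from plug_tuple_in_formulas[OF this B(1) dsB]
    have "satisfies M c (subst (plug_tuple ds) \<psi>) \<longleftrightarrow> satisfies M c' (subst (plug_tuple ds) \<psi>)"
      using realizes_restrict_iff[OF q B(2)] c c'B by blast
    moreover have "nth (x # xs) = case_nat x (nth xs)" for x :: 'a and xs
      by (auto simp: fun_eq_iff split: nat.split)
    ultimately show "sat M (nth (c # ds)) \<psi> \<longleftrightarrow> sat M (nth (c' # ds)) \<psi>"
      by (simp add: satisfies_plug_tuple)
  qed simp
  have \<theta>'A: "\<theta>' \<in> formulas L A {..length (x # ds)}" for x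
    using \<theta>' by (auto simp: formulas_def)
  \<comment> \<open>The two formulas differ syntactically but have the same solutions, which
    suffices for membership in \<open>p\<close>.\<close>
  have instance_iff: "subst (plug_tuple (x # ds)) \<theta>' \<in> p \<longleftrightarrow>
      subst (Var(i := Var 0, j := Par x)) \<theta> \<in> p" if x: "x \<in> univ M" for x
  proof (rule types1_cong[OF p])
    show "subst (plug_tuple (x # ds)) \<theta>' \<in> formulas L (univ M) {0}"
      by (rule plug_tuple_in_formulas[OF \<theta>'A]) (use B dsB x in auto)
    show "subst (Var(i := Var 0, j := Par x)) \<theta> \<in> formulas L (univ M) {0}"
      by (rule product_instance_in_formulas[OF \<theta> B(2) x])
    fix a
    have "sat M (case_nat a (nth (x # ds))) \<theta>' \<longleftrightarrow>
        sat M (case_nat a (nth (x # ds))) (subst (Var(i := Var 0, j := Var 1)) \<theta>)"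
      by (rule sat') simp
    also have "\<dots> \<longleftrightarrow> sat M ((\<lambda>_. a)(j := x)) \<theta>"
      unfolding sat_subst by (rule sat_cong) (use \<theta> \<open>i \<noteq> j\<close> in \<open>auto simp: formulas_def\<close>)
    finally show "satisfies M a (subst (plug_tuple (x # ds)) \<theta>') \<longleftrightarrow>
        satisfies M a (subst (Var(i := Var 0, j := Par x)) \<theta>)"
      unfolding satisfies_plug_tuple satisfies_product_instance[OF \<theta> \<open>i \<noteq> j\<close>] .
  qed
  have "c # ds \<in> lists (univ M)" "c' # ds \<in> lists (univ M)" using cM dsB B by auto
  then have "subst (plug_tuple (c # ds)) \<theta>' \<in> p \<longleftrightarrow> subst (plug_tuple (c' # ds)) \<theta>' \<in> p"
    using inv[unfolded invariant_def, rule_format] st \<theta>'A by blast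
  then have "subst (Var(i := Var 0, j := Par c')) \<theta> \<in> p" using mem instance_iff cM by blast
  with c'D show thesis by (rule that)
qed

text \<open>For \<open>b \<in> B\<close> the formula \<open>\<theta>(b,y)\<close> is over
  \<open>G\<close> and true on \<open>C\<close>, hence in \<open>q\<close> and true at any
  \<open>c\<close> realizing \<open>q\<close> over \<open>G\<close>. So \<open>\<theta>(x,c)\<close>
  is true on \<open>B\<close> and lies in \<open>p\<close>.\<close>

lemma in_type_product:
  assumes p: "p \<in> types1 L M (univ M)" and q: "q \<in> types1 L M (univ M)" and "i \<noteq> j"
    and sat: "saturated L M \<kappa>" and G: "G \<subseteq> univ M" "|G| <o \<kappa>" "B \<subseteq> G"
    and \<theta>: "\<theta> \<in> formulas L G {i, j}"
    and fs: "finitely_satisfiable_in M p G"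
    and pB: "\<And>\<psi>. \<psi> \<in> formulas L (univ M) {0} \<Longrightarrow> (\<And>b. b \<in> B \<Longrightarrow> satisfies M b \<psi>) \<Longrightarrow> \<psi> \<in> p"
    and qC: "\<And>\<psi>. \<psi> \<in> formulas L (univ M) {0} \<Longrightarrow> (\<And>c. c \<in> C \<Longrightarrow> satisfies M c \<psi>) \<Longrightarrow> \<psi> \<in> q"
    and BC: "\<And>b c. b \<in> B \<Longrightarrow> c \<in> C \<Longrightarrow> sat M ((\<lambda>_. b)(j := c)) \<theta>"
  shows "\<theta> \<in> type_product L M \<kappa> i p j q"
proof -
  obtain c where c: "realizes M c (restrict_type L q G)"
    using sat G restrict_type_in_types1[OF q G(1)] unfolding saturated_def by blast
  then have cM: "c \<in> univ M" by (simp add: realizes_def)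
  have \<theta>': "\<theta> \<in> formulas L G {j, i}" using \<theta> by (simp add: insert_commute)
  have swap: "satisfies M y (subst (Var(j := Var 0, i := Par b)) \<theta>) \<longleftrightarrow>
      sat M ((\<lambda>_. b)(j := y)) \<theta>" for b y
    unfolding satisfies_product_instance[OF \<theta>' \<open>i \<noteq> j\<close>[symmetric]]
    by (rule sat_cong) (use \<theta> \<open>i \<noteq> j\<close> in \<open>auto simp: formulas_def\<close>)
  have "subst (Var(i := Var 0, j := Par c)) \<theta> \<in> p"
  proof (rule pB)
    show "subst (Var(i := Var 0, j := Par c)) \<theta> \<in> formulas L (univ M) {0}"
      by (rule product_instance_in_formulas[OF \<theta> G(1) cM])
    fix b assume b: "b \<in> B"
    then have form: "subst (Var(j := Var 0, i := Par b)) \<theta> \<in> formulas L G {0}"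
      using product_instance_in_formulas[OF \<theta>' order_refl] G by blast
    then have "subst (Var(j := Var 0, i := Par b)) \<theta> \<in> q"
      using BC[OF b] formulas_mono[OF G(1) order_refl] by (intro qC) (auto simp: swap)
    then have "sat M ((\<lambda>_. b)(j := c)) \<theta>"
      using realizes_restrict_iff[OF q G(1) c form] swap by blast
    then show "satisfies M b (subst (Var(i := Var 0, j := Par c)) \<theta>)"
      by (simp add: satisfies_product_instance[OF \<theta> \<open>i \<noteq> j\<close>])
  qed
  \<comment> \<open>The set \<open>G\<close> serves both as the set of invariance and as the base
    over which \<open>c\<close> is chosen.\<close>
  then show ?thesis
    using finitely_satisfiable_in_imp_invariant[OF p fs G(1)] G \<theta> c
    unfolding type_product_def by blast
qed

section \<open>Alternating construction of an infinite rectangle\<close>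

lemma exists_new_element:
  assumes p: "p \<in> types1 L M (univ M)" and na: "nonalgebraic M p"
    and fs: "finitely_satisfiable_in M p G" and "i \<noteq> j" and G: "G \<subseteq> univ M"
    and \<theta>: "\<theta> \<in> formulas L G {i, j}"
    and d: "realizes M d (restrict_type L p G)"
    and c: "subst (Var(i := Var 0, j := Par c)) \<theta> \<in> p"
    and F: "finite F" "F \<subseteq> {y\<in>G. sat M ((\<lambda>_. d)(j := y)) \<theta>}"
    and X: "finite X" "X \<subseteq> G"
  shows "\<exists>b\<in>G. b \<notin> X \<and> sat M ((\<lambda>_. b)(j := c)) \<theta> \<and> (\<forall>y\<in>F. sat M ((\<lambda>_. b)(j := y)) \<theta>)"
proof -
  let ?inst = "\<lambda>y. subst (Var(i := Var 0, j := Par y)) \<theta>"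
  let ?neq = "\<lambda>a. Neg (Eq (Var 0) (Par a))"
  \<comment> \<open>As \<open>d\<close> realizes \<open>p\<close> over \<open>G\<close> and
    \<open>y\<close> lies in \<open>G\<close>, the truth of \<open>\<theta>(d,y)\<close> puts
    \<open>\<theta>(x,y)\<close> into \<open>p\<close>.\<close>
  have "?inst y \<in> p" if y: "y \<in> F" for y
  proof -
    have "?inst y \<in> formulas L G {0}"
      by (rule product_instance_in_formulas[OF \<theta> order_refl]) (use y F in auto)
    then have "satisfies M d (?inst y) \<longleftrightarrow> ?inst y \<in> p" by (rule realizes_restrict_iff[OF p G d])
    then show ?thesis
      unfolding satisfies_product_instance[OF \<theta> \<open>i \<noteq> j\<close>] using y F(2) by blast
  qed
  moreover have "?neq a \<in> p" if "a \<in> X" for a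
    using na nonalgebraic_iff_neq[OF p] that X G by blast
  ultimately have "insert (?inst c) (?inst ` F \<union> ?neq ` X) \<subseteq> p" using c by blast
  from finitely_satisfiable_in_finite[OF p fs _ this] F X
  obtain b where "b \<in> G" "\<forall>\<psi>\<in>insert (?inst c) (?inst ` F \<union> ?neq ` X). satisfies M b \<psi>" by auto
  then have "b \<in> G" "satisfies M b (?inst c)" "\<forall>y\<in>F. satisfies M b (?inst y)"
    "\<forall>a\<in>X. satisfies M b (?neq a)" by auto
  then show ?thesis
    unfolding satisfies_product_instance[OF \<theta> \<open>i \<noteq> j\<close>] by (auto simp: satisfies_def)
qed

text \<open>The combinatorial core: finite rectangles grow by one new element on each side at every
  stage, and their union is the result.\<close>

lemma infinite_rectangle:
  assumes P: "\<And>F X. finite F \<Longrightarrow> finite X \<Longrightarrow> F \<subseteq> Q \<Longrightarrow> X \<subseteq> P \<Longrightarrow>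
      \<exists>b\<in>P. b \<notin> X \<and> (\<forall>c\<in>F. R b c)"
    and Q: "\<And>F X. finite F \<Longrightarrow> finite X \<Longrightarrow> F \<subseteq> P \<Longrightarrow> X \<subseteq> Q \<Longrightarrow>
      \<exists>c\<in>Q. c \<notin> X \<and> (\<forall>b\<in>F. R b c)"
  obtains B C where "B \<subseteq> P" "C \<subseteq> Q" "infinite B" "infinite C" "\<And>b c. b \<in> B \<Longrightarrow> c \<in> C \<Longrightarrow> R b c"
proof -
  let ?I = "\<lambda>n (B, C). finite B \<and> finite C \<and> B \<subseteq> P \<and> C \<subseteq> Q \<and> card B = n \<and> card C = n \<and>
    (\<forall>b\<in>B. \<forall>c\<in>C. R b c)"
  let ?S = "\<lambda>n s t. fst s \<subseteq> fst t \<and> snd s \<subseteq> snd t"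
  have "\<exists>f. \<forall>n. ?I n (f n) \<and> ?S n (f n) (f (Suc n))"
  proof (rule dependent_nat_choice)
    have "?I 0 ({}, {})" by simp
    then show "\<exists>s. ?I 0 s" by (rule exI)
  next
    fix s n assume "?I n s"
    then obtain B C where s: "s = (B, C)" and I: "?I n (B, C)" by (cases s) auto
    \<comment> \<open>The element \<open>b\<close> is chosen against \<open>C\<close>, then
      \<open>c\<close> against \<open>insert b B\<close>, so the new pair is covered as
      well.\<close>
    then obtain b where b: "b \<in> P" "b \<notin> B" "\<forall>c\<in>C. R b c" using P[of C B] by auto
    then obtain c where c: "c \<in> Q" "c \<notin> C" "\<forall>b'\<in>insert b B. R b' c"
      using Q[of "insert b B" C] I by auto
    have "?I (Suc n) (insert b B, insert c C) \<and> ?S n s (insert b B, insert c C)"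
      using I b c s by auto
    then show "\<exists>t. ?I (Suc n) t \<and> ?S n s t" by (rule exI)
  qed
  then obtain f where f: "\<And>n. ?I n (f n) \<and> ?S n (f n) (f (Suc n))" by blast
  define B C where "B n = fst (f n)" and "C n = snd (f n)" for n
  have I: "finite (B n)" "finite (C n)" "B n \<subseteq> P" "C n \<subseteq> Q" "card (B n) = n" "card (C n) = n"
    "\<And>b c. b \<in> B n \<Longrightarrow> c \<in> C n \<Longrightarrow> R b c" for n
    using f[of n] by (auto simp: B_def C_def split: prod.splits)
  have inc: "B k \<subseteq> B n" "C k \<subseteq> C n" if "k \<le> n" for k n
    using f lift_Suc_mono_le[of B, OF _ that] lift_Suc_mono_le[of C, OF _ that]
    by (auto simp: B_def C_def)
  \<comment> \<open>A finite union of size \<open>k\<close> could not contain the stage of size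
    \<open>k + 1\<close>.\<close>
  have inf: "infinite (\<Union>n. D n)" if "\<And>n. card (D n) = n" for D :: "nat \<Rightarrow> 'x set"
  proof
    assume "finite (\<Union>n. D n)"
    then have "card (D (Suc (card (\<Union>n. D n)))) \<le> card (\<Union>n. D n)" by (intro card_mono) auto
    then show False using that by simp
  qed
  show thesis
  proof
    show "infinite (\<Union>n. B n)" by (rule inf) (rule I)
    show "infinite (\<Union>n. C n)" by (rule inf) (rule I)
    show "R b c" if bc: "b \<in> (\<Union>n. B n)" "c \<in> (\<Union>n. C n)" for b c
    proof -
      from bc obtain k n where "b \<in> B k" "c \<in> C n" by blast
      \<comment> \<open>Monotonicity brings both elements to a common stage, where \<open>R\<close>
        is known.\<close>
      then have "b \<in> B (max k n)" "c \<in> C (max k n)"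
        using inc(1)[of k "max k n"] inc(2)[of n "max k n"] by auto
      then show ?thesis by (rule I)
    qed
  qed (intro UN_least I)+
qed

section \<open>From rectangles in the group to types and back\<close>

theorem theorem3p4:
  fixes L :: "('f, 'r) language"
    and G M :: "('f, 'r, 'a) struct"
    and H :: "('a, 'b) monoid_scheme"
    and m :: 'f
    and \<kappa> :: "'k rel"
    and \<phi> :: "('f, 'r, 'a) fm"
  assumes "expands_group L m G H"
    and "monster L G M \<kappa>"
    and "\<phi> \<in> formulas L (univ G) {0}"
  shows "(\<exists>B C. B \<subseteq> univ G \<and> infinite B \<and> C \<subseteq> univ G \<and> infinite C \<and>
            B <#>\<^bsub>H\<^esub> C \<subseteq> solutions G \<phi>)
     \<longleftrightarrow>
         (\<exists>p \<in> types1 L M (univ M). \<exists>q \<in> types1 L M (univ M).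
            nonalgebraic M p \<and> nonalgebraic M q \<and>
            finitely_satisfiable_in M p (univ G) \<and> finitely_satisfiable_in M q (univ G) \<and>
            at_product m \<phi> \<in> type_product L M \<kappa> 0 p 1 q \<inter> type_product L M \<kappa> 1 q 0 p)"
proof -
  let ?\<theta> = "at_product m \<phi>"
  have ext: "elementary_ext L G M" and \<kappa>: "Card_order \<kappa>" "natLeq <o \<kappa>" and G: "|univ G| <o \<kappa>"
    and sat: "saturated L M \<kappa>"
    using assms(2) by (auto simp: monster_def)
  have GM: "univ G \<subseteq> univ M" using ext by (simp add: elementary_ext_def)
  have m: "m \<in> funs L" "farity L m = 2"
    and mult: "\<And>x y. x \<in> univ G \<Longrightarrow> y \<in> univ G \<Longrightarrow> fint G m [x, y] = x \<otimes>\<^bsub>H\<^esub> y"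
    and H: "group H" "carrier H = univ G"
    using assms(1) by (auto simp: expands_group_def)
  have \<theta>: "?\<theta> \<in> formulas L (univ G) {0, 1}"
    unfolding at_product_def
    by (rule subst_in_formulas[OF assms(3) order_refl]) (use m in auto)
  then have \<theta>': "?\<theta> \<in> formulas L (univ G) {1, 0}" by (simp add: insert_commute)
  have swap: "sat M ((\<lambda>_. y)(0 := x)) ?\<theta> \<longleftrightarrow> sat M ((\<lambda>_. x)(1 := y)) ?\<theta>" for x y
    by (rule sat_cong) (use \<theta> in \<open>auto simp: formulas_def\<close>)
  \<comment> \<open>On \<open>G\<close> the multiplication of \<open>M\<close> is that of the group,
    and \<open>\<phi>\<close> has the same truth value in \<open>G\<close> and
    \<open>M\<close>.\<close>
  have sat_product: "sat M ((\<lambda>_. x)(1 := y)) ?\<theta> \<longleftrightarrow> x \<otimes>\<^bsub>H\<^esub> y \<in> solutions G \<phi>"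
    if xy: "x \<in> univ G" "y \<in> univ G" for x y
  proof -
    have xyG: "x \<otimes>\<^bsub>H\<^esub> y \<in> univ G"
      using xy H group.is_monoid[OF H(1)] monoid.m_closed by fastforce
    have "fint M m [x, y] = x \<otimes>\<^bsub>H\<^esub> y"
      using elementary_ext_fint[OF ext m xy] mult[OF xy] by simp
    then have "sat M ((\<lambda>_. x)(1 := y)) ?\<theta> \<longleftrightarrow> satisfies M (x \<otimes>\<^bsub>H\<^esub> y) \<phi>"
      unfolding at_product_def sat_subst satisfies_def
      by (intro sat_cong) (use assms(3) in \<open>auto simp: formulas_def\<close>)
    then show ?thesis
      using elementary_ext_satisfies[OF ext assms(3) xyG] xyG by (simp add: solutions_def)
  qed
  show ?thesis
  proof
    assume "\<exists>B C. B \<subseteq> univ G \<and> infinite B \<and> C \<subseteq> univ G \<and> infinite C \<and>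
      B <#>\<^bsub>H\<^esub> C \<subseteq> solutions G \<phi>"
    then obtain B C where B: "B \<subseteq> univ G" "infinite B" and C: "C \<subseteq> univ G" "infinite C"
      and BC: "B <#>\<^bsub>H\<^esub> C \<subseteq> solutions G \<phi>" by blast
    have R: "sat M ((\<lambda>_. b)(1 := c)) ?\<theta>" if "b \<in> B" "c \<in> C" for b c
    proof -
      have "b \<otimes>\<^bsub>H\<^esub> c \<in> solutions G \<phi>" using that BC by (auto simp: set_mult_def)
      then show ?thesis using sat_product B C that by blast
    qed
    then have R': "sat M ((\<lambda>_. c)(0 := b)) ?\<theta>" if "c \<in> C" "b \<in> B" for b c
      unfolding swap using that by blast
    obtain p where p: "p \<in> types1 L M (univ M)" "nonalgebraic M p" "finitely_satisfiable_in M p B"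
      "\<And>\<psi>. \<psi> \<in> formulas L (univ M) {0} \<Longrightarrow> (\<And>b. b \<in> B \<Longrightarrow> satisfies M b \<psi>) \<Longrightarrow> \<psi> \<in> p"
      by (rule exists_type_on_infinite_set[of B M]) (use B GM in blast)+
    obtain q where q: "q \<in> types1 L M (univ M)" "nonalgebraic M q" "finitely_satisfiable_in M q C"
      "\<And>\<psi>. \<psi> \<in> formulas L (univ M) {0} \<Longrightarrow> (\<And>c. c \<in> C \<Longrightarrow> satisfies M c \<psi>) \<Longrightarrow> \<psi> \<in> q"
      by (rule exists_type_on_infinite_set[of C M]) (use C GM in blast)+
    have fs: "finitely_satisfiable_in M p (univ G)" "finitely_satisfiable_in M q (univ G)"
      using p(3) q(3) B C unfolding finitely_satisfiable_in_def by blast+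
    have "?\<theta> \<in> type_product L M \<kappa> 0 p 1 q"
      by (rule in_type_product[OF p(1) q(1) _ sat GM G B(1) \<theta> fs(1) p(4) q(4) R]) simp_all
    moreover have "?\<theta> \<in> type_product L M \<kappa> 1 q 0 p"
      by (rule in_type_product[OF q(1) p(1) _ sat GM G C(1) \<theta>' fs(2) q(4) p(4) R']) simp_all
    ultimately show "\<exists>p \<in> types1 L M (univ M). \<exists>q \<in> types1 L M (univ M).
        nonalgebraic M p \<and> nonalgebraic M q \<and>
        finitely_satisfiable_in M p (univ G) \<and> finitely_satisfiable_in M q (univ G) \<and>
        ?\<theta> \<in> type_product L M \<kappa> 0 p 1 q \<inter> type_product L M \<kappa> 1 q 0 p"
      using p q fs by blast
  next
    assume "\<exists>p \<in> types1 L M (univ M). \<exists>q \<in> types1 L M (univ M).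
        nonalgebraic M p \<and> nonalgebraic M q \<and>
        finitely_satisfiable_in M p (univ G) \<and> finitely_satisfiable_in M q (univ G) \<and>
        ?\<theta> \<in> type_product L M \<kappa> 0 p 1 q \<inter> type_product L M \<kappa> 1 q 0 p"
    then obtain p q where p: "p \<in> types1 L M (univ M)" "nonalgebraic M p"
      "finitely_satisfiable_in M p (univ G)"
      and q: "q \<in> types1 L M (univ M)" "nonalgebraic M q" "finitely_satisfiable_in M q (univ G)"
      and pq: "?\<theta> \<in> type_product L M \<kappa> 0 p 1 q" and qp: "?\<theta> \<in> type_product L M \<kappa> 1 q 0 p"
      by blast
    \<comment> \<open>Enlarging the base ensures that \<open>c\<close>, and likewise
      \<open>d\<close> below, realizes its type over all of \<open>G\<close>.\<close>
    obtain c where c: "realizes M c (restrict_type L q (univ G))"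
      "subst (Var(0 := Var 0, 1 := Par c)) ?\<theta> \<in> p"
      by (rule type_product_realization[OF p(1) q(1) zero_neq_one sat \<kappa> GM G pq])
    obtain d where d: "realizes M d (restrict_type L p (univ G))"
      "subst (Var(1 := Var 0, 0 := Par d)) ?\<theta> \<in> q"
      by (rule type_product_realization[OF q(1) p(1) one_neq_zero sat \<kappa> GM G qp])
    let ?R = "\<lambda>x y. sat M ((\<lambda>_. x)(1 := y)) ?\<theta>"
    \<comment> \<open>Members \<open>b\<close> of \<open>?P\<close> are those with
      \<open>\<theta>(b,y)\<close> in \<open>q\<close>, and members \<open>y\<close> of
      \<open>?Q\<close> those with \<open>\<theta>(x,y)\<close> in \<open>p\<close>; staying in
      these sets keeps the next choice possible.\<close>
    let ?P = "{b \<in> univ G. ?R b c}" and ?Q = "{y \<in> univ G. ?R d y}"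
    obtain B C where BC: "B \<subseteq> ?P" "C \<subseteq> ?Q" "infinite B" "infinite C"
      "\<And>b c. b \<in> B \<Longrightarrow> c \<in> C \<Longrightarrow> ?R b c"
    proof (rule infinite_rectangle[of ?Q ?P ?R])
      fix F X assume "finite F" "finite X" "F \<subseteq> ?Q" "X \<subseteq> ?P"
      then show "\<exists>b\<in>?P. b \<notin> X \<and> (\<forall>y\<in>F. ?R b y)"
        using exists_new_element[OF p zero_neq_one GM \<theta> d(1) c(2), of F X] by blast
    next
      fix F X assume "finite F" "finite X" "F \<subseteq> ?P" "X \<subseteq> ?Q"
      then show "\<exists>y\<in>?Q. y \<notin> X \<and> (\<forall>b\<in>F. ?R b y)"
        using exists_new_element[OF q one_neq_zero GM \<theta>' c(1) d(2), of F X]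
        unfolding swap by blast
    qed blast
    have "b \<otimes>\<^bsub>H\<^esub> c \<in> solutions G \<phi>" if "b \<in> B" "c \<in> C" for b c
      using sat_product BC(1,2) BC(5)[OF that] that by blast
    then have "B <#>\<^bsub>H\<^esub> C \<subseteq> solutions G \<phi>" by (auto simp: set_mult_def)
    then show "\<exists>B C. B \<subseteq> univ G \<and> infinite B \<and> C \<subseteq> univ G \<and> infinite C \<and>
        B <#>\<^bsub>H\<^esub> C \<subseteq> solutions G \<phi>"
      using BC by blast
  qed
qed

end
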